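(* Let $K$ be the discrete Kak-Hilbert transform on $\ell^2$, and let $I$ be the identity operator on $\ell^2$. Then $$U_t=\cos t\, I+\sin t\, K=\operatorname{Re}\left(e^{-it}(I+iK)\right),\qquad t\in\mathbb{R},$$ is a strongly continuous one-parameter group of operators in $\ell^2$, and its infinitesimal generator is $K$.
   Context: $\ell^2$ is the Hilbert space of complex-valued square-summable sequences $\vec a=(a_j)_{j\in\mathbb{Z}}$. The Kak-Hilbert transform $K$ is defined by $$K(\vec a)_k=\begin{cases}\displaystyle\frac2\pi\sum_{n\text{ even}}\frac{a_n}{k-n} & k\text{ odd},\\[2mm] \displaystyle\frac2\pi\sum_{n\text{ odd}}\frac{a_n}{k-n} & k\text{ even},\end{cases}\qquad k\in\mathbb{Z};$$ it is a known fact that $K$ is bounded on $\ell^2$. The real part of an operator is understood formally: if $A,B$ are bounded operators on $\ell^2$ mapping real sequences to real sequences, then $\operatorname{Re}(A+iB)=A$ (here $I$ and $K$ map real sequences to real sequences). A one-parameter group of operators on a Banach space $X$ is a map $U$ from $\mathbb{R}$ to the bounded linear operators on $X$ such that $U(0)$ is the identity and $U(s)\circ U(t)=U(s+t)$ for all $s,t\in\mathbb{R}$. It is strongly continuous if $\lim_{t\to t_0}\|U(t)(x)-U(t_0)(x)\|=0$ for every $x\in X$ and every $t_0\in\mathbb{R}$. Its infinitesimal generator is the operator $A(x)=\lim_{h\to0^+}\frac{U(h)(x)-x}{h}$, whose domain is the set of all $x\in X$ for which this limit exists in $X$. *)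

theory Defs
  imports "HOL-Analysis.Analysis" "HOL-Real_Asymp.Real_Asymp"
begin

text \<open>Complex normed and Banach spaces. The real structure of the library class is kept and complex
  scalars are added on top, so that the norm, limits and \<open>bounded_linear\<close> of the library apply.
  The law \<open>1 *\<^sub>C x = x\<close> follows from \<open>scaleR_scaleC\<close>.\<close>

class scaleC =
  fixes scaleC :: "complex \<Rightarrow> 'a \<Rightarrow> 'a" (infixr "*\<^sub>C" 75)

class complex_normed_vector = real_normed_vector + scaleC +
  assumes scaleC_add_right: "c *\<^sub>C (x + y) = c *\<^sub>C x + c *\<^sub>C y"
    and scaleC_add_left: "(c + d) *\<^sub>C x = c *\<^sub>C x + d *\<^sub>C x"
    and scaleC_scaleC: "c *\<^sub>C (d *\<^sub>C x) = (c * d) *\<^sub>C x"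
    and scaleR_scaleC: "r *\<^sub>R x = complex_of_real r *\<^sub>C x"
    and norm_scaleC: "norm (c *\<^sub>C x) = cmod c * norm x"

class cbanach = complex_normed_vector + complete_space

definition bounded_clinear :: "('a::complex_normed_vector \<Rightarrow> 'b::complex_normed_vector) \<Rightarrow> bool" where
  "bounded_clinear f \<longleftrightarrow> bounded_linear f \<and> (\<forall>c x. f (c *\<^sub>C x) = c *\<^sub>C f x)"

definition one_parameter_group :: "(real \<Rightarrow> 'a::cbanach \<Rightarrow> 'a) \<Rightarrow> bool" where
  "one_parameter_group U \<longleftrightarrow>
     (\<forall>t. bounded_clinear (U t)) \<and> U 0 = id \<and> (\<forall>s t. U s \<circ> U t = U (s + t))"

definition strongly_continuous :: "(real \<Rightarrow> 'a::cbanach \<Rightarrow> 'a) \<Rightarrow> bool" where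
  "strongly_continuous U \<longleftrightarrow> (\<forall>x t\<^sub>0. ((\<lambda>t. norm (U t x - U t\<^sub>0 x)) \<longlongrightarrow> 0) (at t\<^sub>0))"

text \<open>The infinitesimal generator is a partially defined operator; it is given by its domain and its
  values. The value of \<open>generator U x\<close> is meaningful only for \<open>x \<in> generator_domain U\<close>.\<close>

definition generator_domain :: "(real \<Rightarrow> 'a::cbanach \<Rightarrow> 'a) \<Rightarrow> 'a set" where
  "generator_domain U = {x. \<exists>y. ((\<lambda>h. (U h x - x) /\<^sub>R h) \<longlongrightarrow> y) (at_right 0)}"

definition generator :: "(real \<Rightarrow> 'a::cbanach \<Rightarrow> 'a) \<Rightarrow> 'a \<Rightarrow> 'a" where
  "generator U x = Lim (at_right 0) (\<lambda>h. (U h x - x) /\<^sub>R h)"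


subsection \<open>The space \<open>\<ell>\<^sup>2(\<int>)\<close>\<close>

typedef ell2 = "{a :: int \<Rightarrow> complex. (\<lambda>j. (cmod (a j))\<^sup>2) summable_on UNIV}"
  morphisms coord Abs_ell2
  by (rule exI[of _ "\<lambda>_. 0"]) simp

setup_lifting type_definition_ell2

lemma coord_summable: "(\<lambda>j. (cmod (coord a j))\<^sup>2) summable_on A"
  using coord[of a] summable_on_subset_banach[of _ UNIV A] by auto

lemma ell2_eqI: "(\<And>j. coord a j = coord b j) \<Longrightarrow> a = b"
  by (metis coord_inject ext)

lemma summable_sq_add:
  fixes a b :: "'i \<Rightarrow> complex"
  assumes "(\<lambda>j. (cmod (a j))\<^sup>2) summable_on A" "(\<lambda>j. (cmod (b j))\<^sup>2) summable_on A"
  shows "(\<lambda>j. (cmod (a j + b j))\<^sup>2) summable_on A"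
proof (rule summable_on_comparison_test)
  show "(\<lambda>j. 2 * (cmod (a j))\<^sup>2 + 2 * (cmod (b j))\<^sup>2) summable_on A"
    using assms by (intro summable_on_add summable_on_cmult_right)
  show "(cmod (a j + b j))\<^sup>2 \<le> 2 * (cmod (a j))\<^sup>2 + 2 * (cmod (b j))\<^sup>2" for j
  proof -
    have "(cmod (a j + b j))\<^sup>2 \<le> (cmod (a j) + cmod (b j))\<^sup>2"
      by (intro power_mono norm_triangle_ineq) auto
    also have "\<dots> \<le> 2 * (cmod (a j))\<^sup>2 + 2 * (cmod (b j))\<^sup>2"
      using zero_le_power2[of "cmod (a j) - cmod (b j)"] by (simp add: power2_eq_square algebra_simps)
    finally show ?thesis .
  qed
qed auto

lemma summable_sq_mult:
  fixes a :: "'i \<Rightarrow> complex"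
  assumes "(\<lambda>j. (cmod (a j))\<^sup>2) summable_on A"
  shows "(\<lambda>j. (cmod (c * a j))\<^sup>2) summable_on A"
  using summable_on_cmult_right[OF assms, of "(cmod c)\<^sup>2"]
  by (simp add: norm_mult power_mult_distrib)

instantiation ell2 :: real_inner
begin

lift_definition zero_ell2 :: ell2 is "\<lambda>_. 0" by simp
lift_definition plus_ell2 :: "ell2 \<Rightarrow> ell2 \<Rightarrow> ell2" is "\<lambda>a b j. a j + b j"
  by (rule summable_sq_add)
lift_definition uminus_ell2 :: "ell2 \<Rightarrow> ell2" is "\<lambda>a j. - a j" by simp
lift_definition minus_ell2 :: "ell2 \<Rightarrow> ell2 \<Rightarrow> ell2" is "\<lambda>a b j. a j - b j"
  subgoal for a b using summable_sq_add[of a UNIV "\<lambda>j. - b j"] by simp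
  done
lift_definition scaleR_ell2 :: "real \<Rightarrow> ell2 \<Rightarrow> ell2" is "\<lambda>r a j. complex_of_real r * a j"
  by (rule summable_sq_mult)

text \<open>The real inner product of the library class is the real part of the complex inner product
  \<open>\<Sum>\<^sub>j a\<^sub>j cnj b\<^sub>j\<close>.\<close>

definition inner_ell2 :: "ell2 \<Rightarrow> ell2 \<Rightarrow> real" where
  "inner_ell2 a b = (\<Sum>\<^sub>\<infinity>j. Re (coord a j * cnj (coord b j)))"
definition norm_ell2 :: "ell2 \<Rightarrow> real" where
  "norm_ell2 a = sqrt (\<Sum>\<^sub>\<infinity>j. (cmod (coord a j))\<^sup>2)"
definition sgn_ell2 :: "ell2 \<Rightarrow> ell2" where
  "sgn_ell2 a = inverse (norm a) *\<^sub>R a"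
definition dist_ell2 :: "ell2 \<Rightarrow> ell2 \<Rightarrow> real" where
  "dist_ell2 a b = norm (a - b)"
definition uniformity_ell2 :: "(ell2 \<times> ell2) filter" where
  "uniformity_ell2 = (INF e\<in>{0<..}. principal {(x, y). dist x y < e})"
definition open_ell2 :: "ell2 set \<Rightarrow> bool" where
  "open_ell2 S = (\<forall>x\<in>S. \<forall>\<^sub>F (x', y) in uniformity. x' = x \<longrightarrow> y \<in> S)"

lemma summable_inner_abs:
  "(\<lambda>j. cmod (coord a j * cnj (coord b j))) summable_on A"
  using abs_summable_product[of "coord a" A "\<lambda>j. cnj (coord b j)"] coord_summable[of a A] coord_summable[of b A]
  by (simp add: norm_mult power2_eq_square)

lemma summable_inner: "(\<lambda>j. Re (coord a j * cnj (coord b j))) summable_on A"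
  by (rule summable_on_Re[OF abs_summable_summable[OF summable_inner_abs]])

lemma Re_mult_cnj_self: "Re (z * cnj z) = (cmod z)\<^sup>2"
  by (metis Re_complex_of_real complex_mult_cnj complex_norm cmod_power2)

instance
proof
  fix a b c :: ell2 and r s :: real
  show "a + b + c = a + (b + c)" by transfer (simp add: add.assoc)
  show "a + b = b + a" by transfer (simp add: add.commute)
  show "0 + a = a" by transfer simp
  show "- a + a = 0" by transfer simp
  show "a - b = a + - b" by transfer simp
  show "r *\<^sub>R (a + b) = r *\<^sub>R a + r *\<^sub>R b" by transfer (simp add: algebra_simps)
  show "(r + s) *\<^sub>R a = r *\<^sub>R a + s *\<^sub>R a" by transfer (simp add: algebra_simps)
  show "r *\<^sub>R s *\<^sub>R a = (r * s) *\<^sub>R a" by transfer (simp add: algebra_simps)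
  show "1 *\<^sub>R a = a" by transfer simp
  show "sgn a = inverse (norm a) *\<^sub>R a" by (rule sgn_ell2_def)
  show "dist a b = norm (a - b)" by (rule dist_ell2_def)
  show "uniformity = (INF e\<in>{0<..}. principal {(x, y::ell2). dist x y < e})"
    by (rule uniformity_ell2_def)
  show "open S = (\<forall>x\<in>S. \<forall>\<^sub>F (x', y) in uniformity. x' = x \<longrightarrow> y \<in> S)" for S :: "ell2 set"
    by (rule open_ell2_def)
  show "a \<bullet> b = b \<bullet> a"
    unfolding inner_ell2_def by (rule infsum_cong) (simp add: algebra_simps)
  show "(a + b) \<bullet> c = a \<bullet> c + b \<bullet> c"
    unfolding inner_ell2_def
    by (subst infsum_add[symmetric, OF summable_inner summable_inner])
       (rule infsum_cong, simp add: plus_ell2.rep_eq algebra_simps)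
  show "(r *\<^sub>R a) \<bullet> b = r * (a \<bullet> b)"
    unfolding inner_ell2_def
    by (subst infsum_cmult_right[symmetric, OF summable_inner])
       (rule infsum_cong, simp add: scaleR_ell2.rep_eq algebra_simps)
  show "0 \<le> a \<bullet> a"
    unfolding inner_ell2_def Re_mult_cnj_self by (intro infsum_nonneg) auto
  show "(a \<bullet> a = 0) = (a = 0)"
  proof
    assume "a \<bullet> a = 0"
    hence "(cmod (coord a j))\<^sup>2 = 0" for j
      unfolding inner_ell2_def Re_mult_cnj_self
      by (intro nonneg_infsum_le_0D[of "\<lambda>j. (cmod (coord a j))\<^sup>2" UNIV]) (auto simp: coord_summable)
    thus "a = 0" by (intro ell2_eqI) (simp add: zero_ell2.rep_eq)
  qed (simp add: inner_ell2_def zero_ell2.rep_eq)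
  show "norm a = sqrt (a \<bullet> a)"
    unfolding inner_ell2_def Re_mult_cnj_self norm_ell2_def ..
qed

end

instantiation ell2 :: complex_normed_vector
begin

lift_definition scaleC_ell2 :: "complex \<Rightarrow> ell2 \<Rightarrow> ell2" is "\<lambda>c a j. c * a j"
  by (rule summable_sq_mult)

instance
proof
  fix a b :: ell2 and r :: real and u v :: complex
  show "u *\<^sub>C (a + b) = u *\<^sub>C a + u *\<^sub>C b" by transfer (simp add: algebra_simps)
  show "(u + v) *\<^sub>C a = u *\<^sub>C a + v *\<^sub>C a" by transfer (simp add: algebra_simps)
  show "u *\<^sub>C (v *\<^sub>C a) = (u * v) *\<^sub>C a" by transfer (simp add: algebra_simps)
  show "r *\<^sub>R a = complex_of_real r *\<^sub>C a" by transfer simp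
  show "norm (u *\<^sub>C a) = cmod u * norm a"
    unfolding norm_ell2_def
    by (simp add: scaleC_ell2.rep_eq norm_mult power_mult_distrib infsum_cmult_right coord_summable real_sqrt_mult)
qed

end

lemma norm_ell2_sq: "(norm (a::ell2))\<^sup>2 = (\<Sum>\<^sub>\<infinity>j. (cmod (coord a j))\<^sup>2)"
  unfolding norm_ell2_def by (simp add: infsum_nonneg)

lemma ell2_bounded_finite_sums:
  assumes "\<And>F. finite F \<Longrightarrow> (\<Sum>j\<in>F. (cmod (a j))\<^sup>2) \<le> B"
  shows "(\<lambda>j. (cmod (a j))\<^sup>2) summable_on UNIV" "(\<Sum>\<^sub>\<infinity>j. (cmod (a j))\<^sup>2) \<le> B"
proof -
  show *: "(\<lambda>j. (cmod (a j))\<^sup>2) summable_on UNIV"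
    by (rule nonneg_bdd_above_summable_on) (auto simp: bdd_above_def intro!: exI[of _ B] assms)
  show "(\<Sum>\<^sub>\<infinity>j. (cmod (a j))\<^sup>2) \<le> B"
    by (rule infsum_le_finite_sums[OF * assms])
qed

lemma sum_coord_le_norm: "finite F \<Longrightarrow> (\<Sum>j\<in>F. (cmod (coord a j))\<^sup>2) \<le> (norm a)\<^sup>2"
  unfolding norm_ell2_sq by (rule finite_sum_le_infsum) (auto simp: coord_summable)

lemma coord_le_norm: "cmod (coord a j) \<le> norm a"
  using sum_coord_le_norm[of "{j}" a] by (simp add: power2_le_iff_abs_le)

instance ell2 :: cbanach
proof
  fix X :: "nat \<Rightarrow> ell2"
  assume X: "Cauchy X"
  have "Cauchy (\<lambda>n. coord (X n) j)" for j
  proof (rule metric_CauchyI)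
    fix e :: real assume "e > 0"
    then obtain M where M: "\<And>m n. m \<ge> M \<Longrightarrow> n \<ge> M \<Longrightarrow> norm (X m - X n) < e"
      using X unfolding Cauchy_def dist_norm by meson
    have "dist (coord (X m) j) (coord (X n) j) < e" if "m \<ge> M" "n \<ge> M" for m n
      using coord_le_norm[of "X m - X n" j] M[OF that] by (simp add: dist_norm minus_ell2.rep_eq)
    thus "\<exists>M. \<forall>m\<ge>M. \<forall>n\<ge>M. dist (coord (X m) j) (coord (X n) j) < e" by blast
  qed
  then obtain l where l: "\<And>j. (\<lambda>n. coord (X n) j) \<longlonglongrightarrow> l j"
    unfolding Cauchy_convergent_iff convergent_def by metis
  have key: "\<exists>M. \<forall>n\<ge>M. \<forall>F. finite F \<longrightarrow> (\<Sum>j\<in>F. (cmod (coord (X n) j - l j))\<^sup>2) \<le> e\<^sup>2"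
    if "e > 0" for e
  proof -
    obtain M where M: "\<And>m n. m \<ge> M \<Longrightarrow> n \<ge> M \<Longrightarrow> norm (X m - X n) < e"
      using X \<open>e > 0\<close> unfolding Cauchy_def dist_norm by meson
    have "(\<Sum>j\<in>F. (cmod (coord (X n) j - l j))\<^sup>2) \<le> e\<^sup>2" if "n \<ge> M" "finite F" for n F
    proof (rule tendsto_upperbound)
      show "(\<lambda>m. \<Sum>j\<in>F. (cmod (coord (X n) j - coord (X m) j))\<^sup>2)
              \<longlonglongrightarrow> (\<Sum>j\<in>F. (cmod (coord (X n) j - l j))\<^sup>2)"
        by (intro tendsto_intros l)
      show "\<forall>\<^sub>F m in sequentially. (\<Sum>j\<in>F. (cmod (coord (X n) j - coord (X m) j))\<^sup>2) \<le> e\<^sup>2"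
      proof (rule eventually_sequentiallyI[of M])
        fix m assume "m \<ge> M"
        have "(\<Sum>j\<in>F. (cmod (coord (X n) j - coord (X m) j))\<^sup>2) \<le> (norm (X n - X m))\<^sup>2"
          using sum_coord_le_norm[OF \<open>finite F\<close>, of "X n - X m"] by (simp add: minus_ell2.rep_eq)
        also have "\<dots> \<le> e\<^sup>2"
          using M[OF \<open>n \<ge> M\<close> \<open>m \<ge> M\<close>] by (intro power_mono) auto
        finally show "(\<Sum>j\<in>F. (cmod (coord (X n) j - coord (X m) j))\<^sup>2) \<le> e\<^sup>2" .
      qed
    qed simp
    thus ?thesis by blast
  qed
  obtain M where "\<And>F. finite F \<Longrightarrow> (\<Sum>j\<in>F. (cmod (coord (X M) j - l j))\<^sup>2) \<le> 1\<^sup>2"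
    using key[of 1] by auto
  hence "(\<lambda>j. (cmod (coord (X M) j - l j))\<^sup>2) summable_on UNIV"
    by (rule ell2_bounded_finite_sums)
  hence "(\<lambda>j. (cmod (coord (X M) j + - (coord (X M) j - l j)))\<^sup>2) summable_on UNIV"
    by (intro summable_sq_add coord_summable) (simp add: norm_minus_commute)
  hence L: "coord (Abs_ell2 l) = l"
    by (intro Abs_ell2_inverse) simp
  have "X \<longlonglongrightarrow> Abs_ell2 l"
  proof (rule metric_LIMSEQ_I)
    fix e :: real assume "e > 0"
    then obtain M where M: "\<And>n F. n \<ge> M \<Longrightarrow> finite F \<Longrightarrow>
        (\<Sum>j\<in>F. (cmod (coord (X n) j - l j))\<^sup>2) \<le> (e / 2)\<^sup>2"
      using key[of "e / 2"] by auto
    have "dist (X n) (Abs_ell2 l) < e" if "n \<ge> M" for n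
    proof -
      have "(norm (X n - Abs_ell2 l))\<^sup>2 \<le> (e / 2)\<^sup>2"
        unfolding norm_ell2_sq minus_ell2.rep_eq L by (intro ell2_bounded_finite_sums M that)
      hence "norm (X n - Abs_ell2 l) \<le> e / 2"
        by (rule power2_le_imp_le) (use \<open>e > 0\<close> in simp)
      thus ?thesis using \<open>e > 0\<close> by (simp add: dist_norm)
    qed
    thus "\<exists>M. \<forall>n\<ge>M. dist (X n) (Abs_ell2 l) < e" by blast
  qed
  thus "convergent X" by (auto simp: convergent_def)
qed


subsection \<open>Boundedness of the Kak-Hilbert transform\<close>

text \<open>The transform is the infinite matrix \<open>kak_matrix\<close>. Its rows are orthonormal, so Bessel's inequality
  shows that it maps \<open>\<ell>\<^sup>2\<close> to \<open>\<ell>\<^sup>2\<close> and is bounded.\<close>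

definition kak_matrix :: "int \<Rightarrow> int \<Rightarrow> real" where
  "kak_matrix k n = (if even k = even n then 0 else 2 / (pi * of_int (k - n)))"

lemma has_sum_int_split:
  fixes f :: "int \<Rightarrow> 'a::{topological_comm_monoid_add, t2_space}"
  assumes "((\<lambda>n::nat. f (int n)) has_sum a) UNIV" "((\<lambda>n::nat. f (- int n - 1)) has_sum b) UNIV"
  shows "(f has_sum (a + b)) UNIV"
proof -
  have "(f has_sum a) {0..}"
  proof -
    have "bij_betw int UNIV {0..}"
      by (rule bij_betwI[of _ _ _ nat]) auto
    thus ?thesis using assms(1) has_sum_reindex_bij_betw[of int UNIV "{0..}" f a] by simp
  qed
  moreover have "(f has_sum b) {..<0}"
  proof -
    have "bij_betw (\<lambda>n. - int n - 1) UNIV {..<0}"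
      by (rule bij_betwI[of _ _ _ "\<lambda>j. nat (- j - 1)"]) auto
    thus ?thesis
      using assms(2) has_sum_reindex_bij_betw[of "\<lambda>n. - int n - 1" UNIV "{..<0}" f b] by simp
  qed
  ultimately have "(f has_sum (a + b)) ({0..} \<union> {..<0})"
    by (rule has_sum_Un_disjoint) auto
  moreover have "{0..} \<union> {..<0} = (UNIV :: int set)" by auto
  ultimately show ?thesis by simp
qed

definition odd_recip :: "int \<Rightarrow> real" where
  "odd_recip j = 1 / (2 * of_int j + 1)"

lemma odd_recip_nonzero: "2 * of_int j + 1 \<noteq> (0::real)"
proof
  assume "2 * of_int j + 1 = (0::real)"
  hence "of_int (2 * j + 1) = (of_int 0 :: real)" by simp
  hence "2 * j + 1 = 0" by (simp only: of_int_eq_iff)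
  thus False by presburger
qed

lemma odd_squares_sums: "(\<lambda>n. 1 / (2 * real n + 1)\<^sup>2) sums (pi\<^sup>2 / 8)"
proof -
  have "(\<lambda>n. sum (\<lambda>n. 1 / (real n + 1)\<^sup>2) {n * 2..<n * 2 + 2}) sums (pi\<^sup>2 / 6)"
    using sums_group[OF inverse_squares_sums, of 2] by (simp add: add.commute)
  moreover have "sum (\<lambda>n. 1 / (real n + 1)\<^sup>2) {n * 2..<n * 2 + 2}
      = 1 / (2 * real n + 1)\<^sup>2 + 1 / 4 * (1 / (real n + 1)\<^sup>2)" for n
  proof -
    have "{n * 2..<n * 2 + 2} = {2 * n, 2 * n + 1}" by auto
    moreover have "(2 * real n + 2)\<^sup>2 = 4 * (real n + 1)\<^sup>2"
      by (simp add: power2_eq_square algebra_simps)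
    moreover have "real (2 * n) + 1 = 2 * real n + 1" "real (2 * n + 1) + 1 = 2 * real n + 2" by simp_all
    ultimately show ?thesis by (simp add: add.commute)
  qed
  ultimately have "(\<lambda>n. 1 / (2 * real n + 1)\<^sup>2 + 1 / 4 * (1 / (real n + 1)\<^sup>2)) sums (pi\<^sup>2 / 6)"
    by (simp only:)
  from sums_diff[OF this sums_mult[OF inverse_squares_sums, of "1 / 4"]] show ?thesis
    by (simp add: add.commute)
qed

lemma odd_recip_sq_has_sum: "((\<lambda>j. odd_recip j * odd_recip j) has_sum (pi\<^sup>2 / 4)) UNIV"
proof -
  have *: "((\<lambda>n. 1 / (2 * real n + 1)\<^sup>2) has_sum (pi\<^sup>2 / 8)) UNIV"
    by (rule sums_nonneg_imp_has_sum[OF odd_squares_sums]) auto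
  have "1 / (2 * real n + 1)\<^sup>2 = odd_recip (int n) * odd_recip (int n)" for n
    by (simp add: odd_recip_def power2_eq_square)
  moreover have "1 / (2 * real n + 1)\<^sup>2 = odd_recip (- int n - 1) * odd_recip (- int n - 1)" for n
  proof -
    have "odd_recip (- int n - 1) = 1 / (- (2 * real n + 1))"
      by (simp add: odd_recip_def algebra_simps)
    hence "odd_recip (- int n - 1) = - (1 / (2 * real n + 1))"
      by (simp only: divide_minus_right)
    thus ?thesis by (simp only: power2_eq_square minus_mult_minus times_divide_times_eq mult_1_left)
  qed
  ultimately show ?thesis
    using has_sum_int_split[of "\<lambda>j. odd_recip j * odd_recip j" "pi\<^sup>2 / 8" "pi\<^sup>2 / 8"] * by simp
qed

lemma odd_recip_lim: "(\<lambda>n. odd_recip (int n - 1)) \<longlonglongrightarrow> 0" "(\<lambda>n. odd_recip (- int n - 1)) \<longlonglongrightarrow> 0"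
  unfolding odd_recip_def by real_asymp+

lemma odd_recip_diff_has_sum_step: "((\<lambda>j. odd_recip (j - 1) - odd_recip j) has_sum 0) UNIV"
proof -
  let ?h = "\<lambda>j. odd_recip (j - 1) - odd_recip j"
  have h: "?h j = 2 / (4 * (of_int j)\<^sup>2 - 1)" for j
    using odd_recip_nonzero[of j] odd_recip_nonzero[of "j - 1"]
    by (simp add: odd_recip_def field_simps power2_eq_square)
  have ge: "?h j \<ge> 0" if "j \<noteq> 0" for j
  proof -
    have "(1::int) \<le> j\<^sup>2" using that by (simp add: int_one_le_iff_zero_less)
    hence "(1::real) \<le> (of_int j)\<^sup>2" by (metis of_int_1_le_iff of_int_power)
    thus ?thesis unfolding h by simp
  qed
  have "(\<lambda>n. ?h (int n)) sums (odd_recip (- 1) - 0)"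
  proof -
    have "(\<lambda>n. odd_recip (int n - 1) - odd_recip (int (Suc n) - 1)) sums (odd_recip (int 0 - 1) - 0)"
      by (rule telescope_sums'[OF odd_recip_lim(1)])
    thus ?thesis by simp
  qed
  hence 1: "((\<lambda>n. ?h (int n)) has_sum (odd_recip (- 1) - 0)) UNIV"
    by (rule sums_nonneg_imp_has_sum_strong) (auto intro!: eventually_sequentiallyI[of 1] ge[simplified])
  have "(\<lambda>n. ?h (- int n - 1)) sums (0 - odd_recip (- 1))"
  proof -
    have "(\<lambda>n. odd_recip (- int (Suc n) - 1) - odd_recip (- int n - 1)) sums (0 - odd_recip (- int 0 - 1))"
      by (rule telescope_sums[OF odd_recip_lim(2)])
    moreover have "- int (Suc n) - 1 = - int n - 1 - 1" for n by simp
    ultimately show ?thesis by (simp only: of_nat_0 minus_zero diff_0)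
  qed
  hence 2: "((\<lambda>n. ?h (- int n - 1)) has_sum (0 - odd_recip (- 1))) UNIV"
    by (rule sums_nonneg_imp_has_sum) (rule ge, simp)
  show ?thesis using has_sum_int_split[OF 1 2] by simp
qed

lemma has_sum_int_shift:
  fixes f :: "int \<Rightarrow> 'a::{comm_monoid_add, topological_space}"
  assumes "(f has_sum a) UNIV"
  shows "((\<lambda>j. f (j + c)) has_sum a) UNIV"
  using assms has_sum_reindex_bij_betw[of "\<lambda>j. j + c" UNIV UNIV f a]
  by (simp add: bij_betw_def)

lemma odd_recip_diff_has_sum_nat: "((\<lambda>j. odd_recip (j - int d) - odd_recip j) has_sum 0) UNIV"
proof (induction d)
  case (Suc d)
  have "((\<lambda>j. odd_recip (j + - int d - 1) - odd_recip (j + - int d)) has_sum 0) UNIV"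
    by (rule has_sum_int_shift[OF odd_recip_diff_has_sum_step])
  from has_sum_add[OF this Suc] show ?case by (simp add: algebra_simps)
qed simp

lemma odd_recip_diff_has_sum: "((\<lambda>j. odd_recip (j - d) - odd_recip j) has_sum 0) UNIV"
proof (cases "d \<ge> 0")
  case True
  thus ?thesis using odd_recip_diff_has_sum_nat[of "nat d"] by simp
next
  case False
  have "((\<lambda>j. odd_recip (j + - d - int (nat (- d))) - odd_recip (j + - d)) has_sum 0) UNIV"
    by (rule has_sum_int_shift[OF odd_recip_diff_has_sum_nat])
  hence "((\<lambda>j. - (odd_recip (j + - d - int (nat (- d))) - odd_recip (j + - d))) has_sum - 0) UNIV"
    by (subst has_sum_uminus) simp
  thus ?thesis using False by simp
qed

lemma odd_recip_mult_has_sum: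
  "((\<lambda>j. odd_recip j * odd_recip (j - d)) has_sum (if d = 0 then pi\<^sup>2 / 4 else 0)) UNIV"
proof (cases "d = 0")
  case False
  have "odd_recip j * odd_recip (j - d) = 1 / (2 * of_int d) * (odd_recip (j - d) - odd_recip j)" for j
    using odd_recip_nonzero[of j] odd_recip_nonzero[of "j - d"] False
    by (simp add: odd_recip_def field_simps)
  thus ?thesis using has_sum_cmult_right[OF odd_recip_diff_has_sum[of d], of "1 / (2 * of_int d)"] False
    by simp
qed (simp add: odd_recip_sq_has_sum)

lemma kak_matrix_rows_orthonormal:
  "((\<lambda>n. kak_matrix k n * kak_matrix l n) has_sum (if k = l then 1 else 0)) UNIV"
proof (cases "even k = even l")
  case False
  hence "(\<lambda>n. kak_matrix k n * kak_matrix l n) = (\<lambda>_. 0)"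
    by (auto simp: kak_matrix_def fun_eq_iff)
  moreover have "k \<noteq> l" using False by auto
  ultimately show ?thesis by simp
next
  case True
  hence "even (k - l)" by simp
  then obtain d where d: "k - l = 2 * d" by (elim evenE)
  let ?S = "{n::int. even n \<noteq> even k}"
  have bij: "bij_betw (\<lambda>j. k - (2 * j + 1)) UNIV ?S"
  proof (rule bij_betwI[of _ _ _ "\<lambda>n. (k - n - 1) div 2"])
    fix n :: int assume "n \<in> ?S"
    hence "even (k - n - 1)" by auto
    thus "k - (2 * ((k - n - 1) div 2) + 1) = n" by simp
  qed auto
  have eq: "kak_matrix k (k - (2 * j + 1)) * kak_matrix l (k - (2 * j + 1))
      = 4 / pi\<^sup>2 * (odd_recip j * odd_recip (j - d))" for j
  proof -
    have l: "l = k - 2 * d" using d by simp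
    show ?thesis unfolding l
      by (simp add: kak_matrix_def odd_recip_def power2_eq_square field_simps)
  qed
  have "((\<lambda>j. 4 / pi\<^sup>2 * (odd_recip j * odd_recip (j - d))) has_sum
      4 / pi\<^sup>2 * (if d = 0 then pi\<^sup>2 / 4 else 0)) UNIV"
    by (intro has_sum_cmult_right odd_recip_mult_has_sum)
  also have "4 / pi\<^sup>2 * (if d = 0 then pi\<^sup>2 / 4 else 0) = (if k = l then 1 else 0)"
    using d by auto
  finally have "((\<lambda>n. kak_matrix k n * kak_matrix l n) has_sum (if k = l then 1 else 0)) ?S"
    unfolding eq[symmetric]
    using has_sum_reindex_bij_betw[OF bij, of "\<lambda>n. kak_matrix k n * kak_matrix l n"] by simp
  thus ?thesis
    by (rule has_sum_cong_neutral[THEN iffD1, rotated -1]) (auto simp: kak_matrix_def)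
qed

lemma bessel_inequality:
  fixes e :: "'i \<Rightarrow> 'a::real_inner"
  assumes "finite I" "\<And>i j. i \<in> I \<Longrightarrow> j \<in> I \<Longrightarrow> e i \<bullet> e j = (if i = j then 1 else 0)"
  shows "(\<Sum>i\<in>I. (a \<bullet> e i)\<^sup>2) \<le> (norm a)\<^sup>2"
proof -
  let ?s = "\<Sum>i\<in>I. (a \<bullet> e i) *\<^sub>R e i"
  let ?B = "\<Sum>i\<in>I. (a \<bullet> e i)\<^sup>2"
  have "?s \<bullet> e j = a \<bullet> e j" if "j \<in> I" for j
  proof -
    have "?s \<bullet> e j = (\<Sum>i\<in>I. (a \<bullet> e i) * (if i = j then 1 else 0))"
      unfolding inner_sum_left using assms(2) that by (intro sum.cong) auto
    also have "\<dots> = (\<Sum>i\<in>I. if j = i then a \<bullet> e i else 0)" by (intro sum.cong) auto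
    also have "\<dots> = a \<bullet> e j" using assms(1) that by (subst sum.delta') auto
    finally show ?thesis .
  qed
  moreover have "?s \<bullet> ?s = (\<Sum>j\<in>I. (a \<bullet> e j) * (?s \<bullet> e j))"
    unfolding inner_sum_right[of ?s] inner_scaleR_right ..
  ultimately have "?s \<bullet> ?s = ?B" by (simp add: power2_eq_square)
  moreover have "a \<bullet> ?s = ?B" by (simp add: inner_sum_right power2_eq_square)
  moreover have "0 \<le> (a - ?s) \<bullet> (a - ?s)" by (rule inner_ge_zero)
  moreover have "(a - ?s) \<bullet> (a - ?s) = a \<bullet> a - 2 * (a \<bullet> ?s) + ?s \<bullet> ?s"
    by (simp add: inner_diff_left inner_diff_right inner_commute)
  ultimately show ?thesis by (simp add: power2_norm_eq_inner)
qed

lift_definition kak_row :: "int \<Rightarrow> complex \<Rightarrow> ell2" is "\<lambda>k z n. z * complex_of_real (kak_matrix k n)"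
proof (rule summable_sq_mult)
  fix k
  show "(\<lambda>n. (cmod (complex_of_real (kak_matrix k n)))\<^sup>2) summable_on UNIV"
    using has_sum_imp_summable[OF kak_matrix_rows_orthonormal[of k k]] by (simp add: power2_eq_square)
qed

lemma kak_row_inner: "kak_row k z \<bullet> kak_row l w = (if k = l then Re (z * cnj w) else 0)"
proof -
  have "((\<lambda>n. Re (z * cnj w) * (kak_matrix k n * kak_matrix l n)) has_sum Re (z * cnj w) * (if k = l then 1 else 0)) UNIV"
    by (intro has_sum_cmult_right kak_matrix_rows_orthonormal)
  moreover have "Re (coord (kak_row k z) n * cnj (coord (kak_row l w) n))
      = Re (z * cnj w) * (kak_matrix k n * kak_matrix l n)" for n
    by (simp add: kak_row.rep_eq algebra_simps)
  ultimately have "kak_row k z \<bullet> kak_row l w = Re (z * cnj w) * (if k = l then 1 else 0)"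
    unfolding inner_ell2_def by (simp only: infsumI)
  thus ?thesis by simp
qed

lemma kak_matrix_abs_summable:
  "(\<lambda>n. cmod (coord a n * complex_of_real (kak_matrix k n))) summable_on A"
  using summable_inner_abs[of a "kak_row k 1" A] by (simp add: kak_row.rep_eq)

lemma kak_matrix_infsum_inner:
  "Re (cnj z * (\<Sum>\<^sub>\<infinity>n. coord a n * complex_of_real (kak_matrix k n))) = a \<bullet> kak_row k z"
proof -
  have s: "(\<lambda>n. coord a n * complex_of_real (kak_matrix k n)) summable_on UNIV"
    by (rule abs_summable_summable[OF kak_matrix_abs_summable])
  have "Re (cnj z * (\<Sum>\<^sub>\<infinity>n. coord a n * complex_of_real (kak_matrix k n)))
     = Re (\<Sum>\<^sub>\<infinity>n. cnj z * (coord a n * complex_of_real (kak_matrix k n)))"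
    by (subst infsum_cmult_right) (use s in auto)
  also have "\<dots> = (\<Sum>\<^sub>\<infinity>n. Re (cnj z * (coord a n * complex_of_real (kak_matrix k n))))"
    by (rule infsum_Re[symmetric]) (intro summable_on_cmult_right s)
  also have "\<dots> = a \<bullet> kak_row k z"
    unfolding inner_ell2_def kak_row.rep_eq by (intro infsum_cong) (simp add: algebra_simps)
  finally show ?thesis .
qed

lemma kak_matrix_bound:
  assumes "finite F"
  shows "(\<Sum>k\<in>F. (cmod (\<Sum>\<^sub>\<infinity>n. coord a n * complex_of_real (kak_matrix k n)))\<^sup>2) \<le> (norm a)\<^sup>2"
proof -
  have "(\<Sum>i\<in>F \<times> {1, \<i>}. (a \<bullet> (case i of (k, z) \<Rightarrow> kak_row k z))\<^sup>2) \<le> (norm a)\<^sup>2"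
  proof (rule bessel_inequality)
    fix i j assume "i \<in> F \<times> {1, \<i>}" "j \<in> F \<times> {1, \<i>}"
    moreover have "Re (z * cnj w) = (if z = w then 1 else 0)" if "z \<in> {1, \<i>}" "w \<in> {1, \<i>}" for z w
      using that by (auto simp: complex_eq_iff)
    ultimately show "(case i of (k, z) \<Rightarrow> kak_row k z) \<bullet> (case j of (k, z) \<Rightarrow> kak_row k z) = (if i = j then 1 else 0)"
      by (cases i; cases j) (simp only: prod.case kak_row_inner prod.inject mem_Times_iff fst_conv snd_conv, simp)
  qed (use assms in simp)
  also have "(\<Sum>i\<in>F \<times> {1, \<i>}. (a \<bullet> (case i of (k, z) \<Rightarrow> kak_row k z))\<^sup>2)
      = (\<Sum>k\<in>F. \<Sum>z\<in>{1, \<i>}. (a \<bullet> kak_row k z)\<^sup>2)"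
    by (subst sum.cartesian_product) (auto intro!: sum.cong)
  also have "\<dots> = (\<Sum>k\<in>F. (cmod (\<Sum>\<^sub>\<infinity>n. coord a n * complex_of_real (kak_matrix k n)))\<^sup>2)"
    unfolding kak_matrix_infsum_inner[symmetric] by (simp add: cmod_power2)
  finally show ?thesis .
qed

lemma kak_even_sum:
  assumes "odd k"
  shows "complex_of_real (2 / pi) * (\<Sum>\<^sub>\<infinity>n\<in>{n. even n}. a n / of_int (k - n))
       = (\<Sum>\<^sub>\<infinity>n. a n * complex_of_real (kak_matrix k n))"
  unfolding infsum_cmult_right'[symmetric]
  by (rule infsum_cong_neutral) (use assms in \<open>auto simp: kak_matrix_def field_simps\<close>)

lemma kak_odd_sum:
  assumes "even k"
  shows "complex_of_real (2 / pi) * (\<Sum>\<^sub>\<infinity>n\<in>{n. odd n}. a n / of_int (k - n))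
       = (\<Sum>\<^sub>\<infinity>n. a n * complex_of_real (kak_matrix k n))"
  unfolding infsum_cmult_right'[symmetric]
  by (rule infsum_cong_neutral) (use assms in \<open>auto simp: kak_matrix_def field_simps\<close>)


subsection \<open>The Kak-Hilbert transform and the real part of an operator\<close>

text \<open>For \<open>a \<in> \<ell>\<^sup>2\<close> all the series converge absolutely (\<open>kak_matrix_abs_summable\<close>), so the unordered
  sums are the usual ones.\<close>

lift_definition kak :: "ell2 \<Rightarrow> ell2" is
  "\<lambda>a k. if odd k
      then complex_of_real (2 / pi) * (\<Sum>\<^sub>\<infinity>n\<in>{n. even n}. a n / of_int (k - n))
      else complex_of_real (2 / pi) * (\<Sum>\<^sub>\<infinity>n\<in>{n. odd n}. a n / of_int (k - n))"
proof -
  fix a :: "int \<Rightarrow> complex"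
  assume "(\<lambda>j. (cmod (a j))\<^sup>2) summable_on UNIV"
  then obtain b where a: "a = coord b" using coord_cases by blast
  show "(\<lambda>k. (cmod (if odd k
      then complex_of_real (2 / pi) * (\<Sum>\<^sub>\<infinity>n\<in>{n. even n}. a n / of_int (k - n))
      else complex_of_real (2 / pi) * (\<Sum>\<^sub>\<infinity>n\<in>{n. odd n}. a n / of_int (k - n))))\<^sup>2) summable_on UNIV"
    by (rule ell2_bounded_finite_sums[of _ "(norm b)\<^sup>2"], subst sum.cong[OF refl], subst if_cong[OF refl kak_even_sum kak_odd_sum])
       (auto simp: a kak_matrix_bound)
qed

lemma coord_kak: "coord (kak a) k = (\<Sum>\<^sub>\<infinity>n. coord a n * complex_of_real (kak_matrix k n))"
proof (cases "odd k")
  case True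
  thus ?thesis unfolding kak.rep_eq kak_even_sum[OF True] by (rule if_P)
next
  case False
  hence "even k" by simp
  from False show ?thesis unfolding kak.rep_eq kak_odd_sum[OF \<open>even k\<close>] by (rule if_not_P)
qed

lemma norm_kak_le: "norm (kak a) \<le> norm a"
proof (rule power2_le_imp_le)
  show "(norm (kak a))\<^sup>2 \<le> (norm a)\<^sup>2"
    unfolding norm_ell2_sq[of "kak a"] coord_kak by (intro ell2_bounded_finite_sums kak_matrix_bound)
qed simp

lemma kak_add: "kak (a + b) = kak a + kak b"
proof (rule ell2_eqI)
  fix k
  show "coord (kak (a + b)) k = coord (kak a + kak b) k"
    unfolding coord_kak plus_ell2.rep_eq
    by (subst infsum_add[symmetric, OF abs_summable_summable[OF kak_matrix_abs_summable] abs_summable_summable[OF kak_matrix_abs_summable]])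
       (rule infsum_cong, simp add: algebra_simps)
qed

lemma kak_scaleC: "kak (c *\<^sub>C a) = c *\<^sub>C kak a"
proof (rule ell2_eqI)
  fix k
  show "coord (kak (c *\<^sub>C a)) k = coord (c *\<^sub>C kak a) k"
    unfolding coord_kak scaleC_ell2.rep_eq
    by (subst infsum_cmult_right'[symmetric]) (rule infsum_cong, simp add: algebra_simps)
qed

lemma bounded_clinear_kak: "bounded_clinear kak"
  unfolding bounded_clinear_def
proof (intro conjI allI kak_scaleC)
  show "bounded_linear kak"
    by (rule bounded_linear_intro[where K = 1])
       (auto simp: kak_add kak_scaleC scaleR_scaleC norm_kak_le)
qed

definition real_sequence :: "ell2 \<Rightarrow> bool" where
  "real_sequence a \<longleftrightarrow> (\<forall>j. coord a j \<in> \<real>)"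

definition real_operator :: "(ell2 \<Rightarrow> ell2) \<Rightarrow> bool" where
  "real_operator A \<longleftrightarrow> bounded_clinear A \<and> (\<forall>a. real_sequence a \<longrightarrow> real_sequence (A a))"

text \<open>\<open>Re_op (A + iB) = A\<close> for real operators \<open>A\<close>, \<open>B\<close>; by \<open>Re_op_eqI\<close> below this is well defined.\<close>

definition Re_op :: "(ell2 \<Rightarrow> ell2) \<Rightarrow> ell2 \<Rightarrow> ell2" where
  "Re_op T = (THE A. real_operator A \<and> (\<exists>B. real_operator B \<and> (\<forall>a. T a = A a + \<i> *\<^sub>C B a)))"

lemma real_operator_decomp_unique:
  assumes "real_operator A" "real_operator B" "real_operator A'" "real_operator B'"
    and eq: "\<And>a. A a + \<i> *\<^sub>C B a = A' a + \<i> *\<^sub>C B' a"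
  shows "A = A'"
proof
  have re: "A a = A' a" if "real_sequence a" for a
  proof (rule ell2_eqI)
    fix j
    have "coord (A a) j + \<i> * coord (B a) j = coord (A' a) j + \<i> * coord (B' a) j"
      using arg_cong[OF eq[of a], of "\<lambda>x. coord x j"] by (simp add: plus_ell2.rep_eq scaleC_ell2.rep_eq)
    moreover have "coord (A a) j \<in> \<real>" "coord (B a) j \<in> \<real>" "coord (A' a) j \<in> \<real>" "coord (B' a) j \<in> \<real>"
      using assms that by (auto simp: real_operator_def real_sequence_def)
    ultimately show "coord (A a) j = coord (A' a) j"
      by (auto simp: complex_eq_iff complex_is_Real_iff)
  qed
  fix a :: ell2
  have fin: "(\<lambda>j. (cmod (complex_of_real (Re (coord a j))))\<^sup>2) summable_on UNIV"
    by (rule summable_on_comparison_test[OF coord_summable[of a UNIV]]) (auto simp: cmod_power2)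
  have fin': "(\<lambda>j. (cmod (complex_of_real (Im (coord a j))))\<^sup>2) summable_on UNIV"
    by (rule summable_on_comparison_test[OF coord_summable[of a UNIV]]) (auto simp: cmod_power2)
  define x where "x = Abs_ell2 (\<lambda>j. complex_of_real (Re (coord a j)))"
  define y where "y = Abs_ell2 (\<lambda>j. complex_of_real (Im (coord a j)))"
  have x: "coord x j = complex_of_real (Re (coord a j))" and y: "coord y j = complex_of_real (Im (coord a j))" for j
    unfolding x_def y_def using fin fin' by (simp_all add: Abs_ell2_inverse)
  have a: "a = x + \<i> *\<^sub>C y"
    by (rule ell2_eqI) (simp add: plus_ell2.rep_eq scaleC_ell2.rep_eq x y complex_eq_iff)
  have lin: "C (x + \<i> *\<^sub>C y) = C x + \<i> *\<^sub>C C y" if "real_operator C" for C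
    using that by (simp add: real_operator_def bounded_clinear_def linear_add bounded_linear.linear)
  have "real_sequence x" "real_sequence y" by (auto simp: real_sequence_def x y)
  thus "A a = A' a" unfolding a lin[OF assms(1)] lin[OF assms(3)] by (simp add: re)
qed

lemma Re_op_eqI:
  assumes "real_operator A" "real_operator B" "\<And>a. T a = A a + \<i> *\<^sub>C B a"
  shows "Re_op T = A"
  unfolding Re_op_def
proof (rule the_equality)
  show "real_operator A \<and> (\<exists>B. real_operator B \<and> (\<forall>a. T a = A a + \<i> *\<^sub>C B a))"
    using assms by blast
  fix A' assume "real_operator A' \<and> (\<exists>B. real_operator B \<and> (\<forall>a. T a = A' a + \<i> *\<^sub>C B a))"
  then obtain B' where "real_operator A'" "real_operator B'" "\<And>a. T a = A' a + \<i> *\<^sub>C B' a" by blast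
  thus "A' = A" using real_operator_decomp_unique[of A' B' A B] assms by metis
qed

end

theory Submission
  imports Defs
begin

text \<open>Everything rests on the identity \<open>K (K a) = - a\<close>: then \<open>cos t I + sin t K\<close> is the exponential
  \<open>exp (t K)\<close>, its group law is the pair of addition theorems for cosine and sine, and its derivative
  at \<open>0\<close> is \<open>K\<close>, in the norm sense and on the whole space.

  The rows of the matrix of \<open>K\<close> are orthonormal, and the matrix is antisymmetric, so formally
  \<open>K K = - K K\<^sup>T = - I\<close>. Composing the two transforms entrywise would require
  an interchange of two infinite sums. The Hilbert space structure avoids this.
  By antisymmetry \<open>K\<close> sends the unit vectors to the negated rows (\<open>kak_unit_vector\<close>), hence
  preserves their norms. A contraction that preserves the norm of a vector \<open>b\<close> also preserves all inner
  products with \<open>b\<close> (\<open>contraction_inner_eq\<close>). The \<open>k\<close>-th coordinate of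
  \<open>K (K a)\<close> is the inner product of \<open>K a\<close> with the \<open>k\<close>-th row, that is, with the negative of \<open>K\<close> applied to
  the \<open>k\<close>-th unit vector; so it is minus the \<open>k\<close>-th coordinate of \<open>a\<close> (\<open>kak_kak\<close>).

  For the real part, expanding \<open>e\<^sup>-\<^sup>i\<^sup>t (I + i K)\<close> with Euler's formula gives
  \<open>(cos t I + sin t K) + i (cos t K - sin t I)\<close>, and both brackets preserve real sequences.\<close>

text \<open>The defect \<open>x \<bullet> y - T x \<bullet> T y\<close> of a contraction is a positive semidefinite form, and by the
  Cauchy-Schwarz argument a null vector of its quadratic form is orthogonal to everything.\<close>

lemma contraction_inner_eq:
  fixes T :: "'a::real_inner \<Rightarrow> 'b::real_inner"
  assumes lin: "linear T" and contr: "\<And>x. norm (T x) \<le> norm x" and b: "norm (T b) = norm b"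
  shows "T a \<bullet> T b = a \<bullet> b"
proof (rule ccontr)
  define c where "c = a \<bullet> b - T a \<bullet> T b"
  define d where "d = a \<bullet> a - T a \<bullet> T a"
  assume "T a \<bullet> T b \<noteq> a \<bullet> b"
  hence "c \<noteq> 0" by (simp add: c_def)
  have bb: "T b \<bullet> T b = b \<bullet> b" using b by (simp add: norm_eq)
  have "0 \<le> d + 2 * t * c" for t
  proof -
    have "T (a + t *\<^sub>R b) \<bullet> T (a + t *\<^sub>R b) \<le> (a + t *\<^sub>R b) \<bullet> (a + t *\<^sub>R b)"
      using contr by (simp add: norm_le)
    thus ?thesis
      by (simp add: linear_add[OF lin] linear_cmul[OF lin] inner_add_left inner_add_right bb
          inner_commute c_def d_def algebra_simps)
  qed
  \<comment> \<open>A nonconstant affine function of \<open>t\<close> takes the value \<open>- 1\<close>.\<close>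
  from this[of "- (d + 1) / (2 * c)"] \<open>c \<noteq> 0\<close> show False by (simp add: field_simps)
qed

lift_definition unit_vector :: "int \<Rightarrow> complex \<Rightarrow> ell2" is "\<lambda>k z n. if n = k then z else 0"
proof -
  fix k and z :: complex
  have "(\<lambda>n. (cmod z)\<^sup>2) summable_on {k}" by (rule summable_on_finite) simp
  thus "(\<lambda>n. (cmod (if n = k then z else 0))\<^sup>2) summable_on UNIV"
    by (rule summable_on_cong_neutral[THEN iffD1, rotated -1]) auto
qed

lemma inner_unit_vector: "a \<bullet> unit_vector k z = Re (coord a k * cnj z)"
proof -
  have "a \<bullet> unit_vector k z = (\<Sum>\<^sub>\<infinity>n\<in>{k}. Re (coord a n * cnj z))"
    unfolding inner_ell2_def unit_vector.rep_eq by (rule infsum_cong_neutral) auto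
  thus ?thesis by simp
qed

lemma kak_matrix_antisym: "kak_matrix n k = - kak_matrix k n"
proof -
  have "pi * of_int (n - k) = - (pi * real_of_int (k - n))" by (simp add: algebra_simps)
  thus ?thesis unfolding kak_matrix_def by (simp only: divide_minus_right) auto
qed

lemma kak_unit_vector: "kak (unit_vector k z) = - kak_row k z"
proof (rule ell2_eqI)
  fix j
  have "coord (kak (unit_vector k z)) j = (\<Sum>\<^sub>\<infinity>n\<in>{k}. z * complex_of_real (kak_matrix j n))"
    unfolding coord_kak unit_vector.rep_eq by (rule infsum_cong_neutral) auto
  thus "coord (kak (unit_vector k z)) j = coord (- kak_row k z) j"
    by (simp add: uminus_ell2.rep_eq kak_row.rep_eq kak_matrix_antisym[of j k])
qed

lemma inner_kak_row: "a \<bullet> kak_row k z = Re (coord (kak a) k * cnj z)"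
  unfolding coord_kak kak_matrix_infsum_inner[symmetric] by (simp only: mult.commute)

lemma linear_kak: "linear kak"
  using bounded_clinear_kak by (simp add: bounded_clinear_def bounded_linear.linear)

theorem kak_kak: "kak (kak a) = - a"
proof (rule ell2_eqI)
  fix k
  have "Re (coord (kak (kak a)) k * cnj z) = Re (- coord a k * cnj z)" for z
  proof -
    have "norm (kak (unit_vector k z)) = norm (unit_vector k z)"
      by (simp add: kak_unit_vector norm_eq kak_row_inner inner_unit_vector unit_vector.rep_eq)
    hence "kak a \<bullet> kak (unit_vector k z) = a \<bullet> unit_vector k z"
      by (rule contraction_inner_eq[OF linear_kak norm_kak_le])
    thus ?thesis by (simp add: kak_unit_vector inner_kak_row inner_unit_vector)
  qed
  \<comment> \<open>The values \<open>1\<close> and \<open>\<i>\<close> of \<open>z\<close> give the real and the imaginary part.\<close>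
  from this[of 1] this[of \<i>] show "coord (kak (kak a)) k = coord (- a) k"
    by (simp add: complex_eq_iff uminus_ell2.rep_eq)
qed

text \<open>The imaginary part of a coordinate of \<open>K a\<close> is the inner product of \<open>a\<close> with a row of purely
  imaginary entries, which vanishes termwise for real \<open>a\<close>.\<close>

lemma real_sequence_kak:
  assumes "real_sequence a"
  shows "real_sequence (kak a)"
  unfolding real_sequence_def
proof
  fix k
  have "Im (coord (kak a) k) = a \<bullet> kak_row k \<i>" by (simp add: inner_kak_row)
  also have "\<dots> = 0"
    unfolding inner_ell2_def kak_row.rep_eq
    using assms by (intro infsum_0) (simp add: real_sequence_def complex_is_Real_iff)
  finally show "coord (kak a) k \<in> \<real>" by (simp add: complex_is_Real_iff)
qed

lemma real_operator_kak_combination: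
  "real_operator (\<lambda>a. complex_of_real r *\<^sub>C a + complex_of_real s *\<^sub>C kak a)"
  unfolding real_operator_def bounded_clinear_def
proof (intro conjI allI impI)
  have "bounded_linear kak" using bounded_clinear_kak by (simp add: bounded_clinear_def)
  thus "bounded_linear (\<lambda>a. complex_of_real r *\<^sub>C a + complex_of_real s *\<^sub>C kak a)"
    unfolding scaleR_scaleC[symmetric]
    by (intro bounded_linear_add bounded_linear_const_scaleR bounded_linear_ident)
  show "complex_of_real r *\<^sub>C c *\<^sub>C a + complex_of_real s *\<^sub>C kak (c *\<^sub>C a)
      = c *\<^sub>C (complex_of_real r *\<^sub>C a + complex_of_real s *\<^sub>C kak a)" for c a
    by (simp add: kak_scaleC scaleC_scaleC scaleC_add_right mult.commute)
  show "real_sequence (complex_of_real r *\<^sub>C a + complex_of_real s *\<^sub>C kak a)" if "real_sequence a" for a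
    using that real_sequence_kak[OF that]
    by (simp add: real_sequence_def plus_ell2.rep_eq scaleC_ell2.rep_eq)
qed

lemma Re_op_exp_kak:
  "Re_op (\<lambda>a. exp (- \<i> * complex_of_real t) *\<^sub>C (a + \<i> *\<^sub>C kak a))
    = (\<lambda>a. complex_of_real (cos t) *\<^sub>C a + complex_of_real (sin t) *\<^sub>C kak a)"
proof (rule Re_op_eqI[OF real_operator_kak_combination real_operator_kak_combination])
  fix a
  have "exp (- \<i> * complex_of_real t) = Complex (cos t) (- sin t)"
    by (simp add: complex_eq_iff Re_exp Im_exp)
  thus "exp (- \<i> * complex_of_real t) *\<^sub>C (a + \<i> *\<^sub>C kak a)
      = (complex_of_real (cos t) *\<^sub>C a + complex_of_real (sin t) *\<^sub>C kak a)
        + \<i> *\<^sub>C (complex_of_real (- sin t) *\<^sub>C a + complex_of_real (cos t) *\<^sub>C kak a)"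
    by (intro ell2_eqI) (simp add: plus_ell2.rep_eq scaleC_ell2.rep_eq complex_eq_iff algebra_simps)
qed

lemma kak_rotation_add:
  "cos s *\<^sub>R (cos t *\<^sub>R a + sin t *\<^sub>R kak a) + sin s *\<^sub>R kak (cos t *\<^sub>R a + sin t *\<^sub>R kak a)
    = cos (s + t) *\<^sub>R a + sin (s + t) *\<^sub>R kak a"
  by (simp add: linear_add[OF linear_kak] linear_cmul[OF linear_kak] kak_kak cos_add sin_add
      algebra_simps)

lemma kak_rotation_difference_quotient:
  "((\<lambda>h. (cos h *\<^sub>R a + sin h *\<^sub>R kak a - a) /\<^sub>R h) \<longlongrightarrow> kak a) (at_right 0)"
proof -
  have "((\<lambda>h::real. (cos h - 1) / h) \<longlongrightarrow> 0) (at_right 0)" by real_asymp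
  moreover have "((\<lambda>h::real. sin h / h) \<longlongrightarrow> 1) (at_right 0)" by real_asymp
  ultimately have "((\<lambda>h. ((cos h - 1) / h) *\<^sub>R a + (sin h / h) *\<^sub>R kak a) \<longlongrightarrow> 0 *\<^sub>R a + 1 *\<^sub>R kak a)
      (at_right 0)"
    by (intro tendsto_intros)
  moreover have "((cos h - 1) / h) *\<^sub>R a + (sin h / h) *\<^sub>R kak a
      = (cos h *\<^sub>R a + sin h *\<^sub>R kak a - a) /\<^sub>R h" for h
    by (simp add: divide_inverse algebra_simps)
  ultimately show ?thesis by simp
qed

theorem theorem1p2:
  fixes U :: "real \<Rightarrow> ell2 \<Rightarrow> ell2"
  assumes U_def: "\<And>t a. U t a = complex_of_real (cos t) *\<^sub>C a + complex_of_real (sin t) *\<^sub>C kak a"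
  shows "(\<forall>t. U t = Re_op (\<lambda>a. exp (- \<i> * complex_of_real t) *\<^sub>C (a + \<i> *\<^sub>C kak a))) \<and>
         one_parameter_group U \<and> strongly_continuous U \<and>
         generator_domain U = UNIV \<and> generator U = kak"
proof (intro conjI allI)
  have U: "U t a = cos t *\<^sub>R a + sin t *\<^sub>R kak a" for t a
    by (simp add: U_def scaleR_scaleC)
  have U_eq: "U t = (\<lambda>a. complex_of_real (cos t) *\<^sub>C a + complex_of_real (sin t) *\<^sub>C kak a)" for t
    by (rule ext) (rule U_def)
  show "U t = Re_op (\<lambda>a. exp (- \<i> * complex_of_real t) *\<^sub>C (a + \<i> *\<^sub>C kak a))" for t
    unfolding Re_op_exp_kak by (rule U_eq)
  show "one_parameter_group U"
    unfolding one_parameter_group_def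
  proof (intro conjI allI)
    show "bounded_clinear (U t)" for t
      using real_operator_kak_combination unfolding U_eq real_operator_def by blast
    show "U 0 = id" by (simp add: fun_eq_iff U)
    show "U s \<circ> U t = U (s + t)" for s t by (simp add: fun_eq_iff U kak_rotation_add)
  qed
  show "strongly_continuous U"
    unfolding strongly_continuous_def
  proof (intro allI)
    fix x t\<^sub>0
    have "((\<lambda>t. U t x) \<longlongrightarrow> U t\<^sub>0 x) (at t\<^sub>0)"
      unfolding U by (intro tendsto_intros)
    thus "((\<lambda>t. norm (U t x - U t\<^sub>0 x)) \<longlongrightarrow> 0) (at t\<^sub>0)"
      by (intro tendsto_norm_zero LIM_zero)
  qed
  have lim: "((\<lambda>h. (U h x - x) /\<^sub>R h) \<longlongrightarrow> kak x) (at_right 0)" for x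
    unfolding U by (rule kak_rotation_difference_quotient)
  show "generator_domain U = UNIV"
    unfolding generator_domain_def using lim by blast
  show "generator U = kak"
    unfolding generator_def using tendsto_Lim[OF _ lim] by (simp add: fun_eq_iff)
qed

end
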